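(* Let $\mathbb{F}$ be an algebraically closed field with $\mathrm{Char}(\mathbb{F})\neq 2$ and let $d\ge 3$. Let $B,A^*$ be a bipartite Leonard pair over $\mathbb{F}$ with diameter $d$ that has reinforced dual $q$-Krawtchouk type, with a parameter array $(\{\theta'_i\}_{i=0}^d;\{\theta^*_i\}_{i=0}^d;\{\varphi'_i\}_{i=1}^d;\{\phi'_i\}_{i=1}^d)$ and corresponding primary $q$-data $(\delta',\mu',h',\delta^*,\mu^*,h^*,\tau')$. Assume $B,A^*$ is in normalized TD/D form, that is, the underlying vector space is $\mathbb{F}^{d+1}$, $B$ is the tridiagonal matrix in $\mathrm{Mat}_{d+1}(\mathbb{F})$ with zero diagonal, all subdiagonal entries $1$ and superdiagonal entries $x'_1,\dots,x'_d$, and $A^*=\mathrm{diag}(\theta^*_0,\dots,\theta^*_d)$. Let $K=\mathrm{diag}(q^{-d},q^{2-d},\dots,q^{d})$, the diagonal matrix in $\mathrm{Mat}_{d+1}(\mathbb{F})$ with $(i,i)$-entry $q^{2i-d}$ for $0\le i\le d$. Let $\delta,\mu,h,\tau\in\mathbb{F}$ satisfy: $\mu\neq0$; $\mu\neq\pm\sqrt{-1}\,\mu'q^i$ for $1-d\le i\le d-1$; $\tau=0$; $h=\mu'h'/\mu$. (Equivalently, $(\delta,\mu,h,\delta^*,\mu^*,h^*,\tau)$ is a primary $q$-data of a near-bipartite expansion of $B,A^*$.) Let $A,A^*$ denote the near-bipartite expansion of $B,A^*$ that has primary $q$-data $(\delta,\mu,h,\delta^*,\mu^*,h^*,\tau)$.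 (i) Assume that $\mu^*=0$. Then $A=B+(\mu+h)K+\delta I$. (ii) Assume that $h^*=0$. Then $A=B+(\mu+h)K^{-1}+\delta I$.
   Context: A tridiagonal matrix is irreducible if all its subdiagonal and superdiagonal entries are nonzero. Let $V$ be a vector space over $\mathbb{F}$ of dimension $d+1$. A Leonard pair on $V$ (with diameter $d$, over $\mathbb{F}$) is an ordered pair $A,A^*$ in $\mathrm{End}(V)$ such that (a) some basis of $V$ makes the matrix of $A$ irreducible tridiagonal and that of $A^*$ diagonal; (b) some basis of $V$ makes the matrix of $A^*$ irreducible tridiagonal and that of $A$ diagonal. ($A^*$ is just a name, not an adjoint.) Matrices act on $\mathbb{F}^{d+1}$ by left multiplication; rows and columns are indexed $0,\dots,d$. Each of $A,A^*$ then has $d+1$ distinct eigenvalues. Flat part: let $E^*_0,\dots,E^*_d$ be the primitive idempotents of $A^*$ (projections onto its eigenspaces along the sum of the other eigenspaces). The flat part of $A$ is $F=\sum_{i=0}^d E^*_i A E^*_i$. $A,A^*$ is bipartite if $F=0$. $A,A^*$ is near-bipartite if $A-F,A^*$ is a Leonard pair on $V$; in that case $A-F,A^*$ is a bipartite Leonard pair called the bipartite contraction of $A,A^*$. A near-bipartite expansion of a bipartite Leonard pair $B,A^*$ on $V$ is a near-bipartite Leonard pair $A,A^*$ on $V$ whose bipartite contraction equals $B,A^*$. Parameter array: an ordering $\{\theta_i\}_{i=0}^d$ of the eigenvalues of $A$ is standard if in some basis $A$ is $\mathrm{diag}(\theta_0,\dots,\theta_d)$ and $A^*$ is irreducible tridiagonal;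 a standard ordering $\{\theta^*_i\}_{i=0}^d$ of the eigenvalues of $A^*$ is defined with the roles of $A$ and $A^*$ exchanged. Given standard orderings, there are unique scalars $\{\varphi_i\}_{i=1}^d$ such that in some basis $A$ is lower bidiagonal with diagonal $\theta_0,\dots,\theta_d$ and all subdiagonal entries $1$, while $A^*$ is upper bidiagonal with diagonal $\theta^*_0,\dots,\theta^*_d$ and superdiagonal $\varphi_1,\dots,\varphi_d$; and unique scalars $\{\phi_i\}_{i=1}^d$ such that in some basis $A$ is lower bidiagonal with diagonal $\theta_d,\theta_{d-1},\dots,\theta_0$ and all subdiagonal entries $1$, while $A^*$ is upper bidiagonal with diagonal $\theta^*_0,\dots,\theta^*_d$ and superdiagonal $\phi_1,\dots,\phi_d$. The sequence $(\{\theta_i\};\{\theta^*_i\};\{\varphi_i\};\{\phi_i\})$ is a parameter array of $A,A^*$. Type I: for $d\ge 3$ it is known that $\frac{\theta_{i-2}-\theta_{i+1}}{\theta_{i-1}-\theta_i}$ and $\frac{\theta^*_{i-2}-\theta^*_{i+1}}{\theta^*_{i-1}-\theta^*_i}$ are equal and independent of $i$ for $2\le i\le d-1$; their common value is written $\beta+1$, and $\beta$ is the fundamental constant. $A,A^*$ has type I if $\beta\neq\pm2$; then fix nonzero $q\in\mathbb{F}$ with $\beta=q^2+q^{-2}$ (so $q^4\ne1$). (Since $\beta$ is determined by $A^*$, a bipartite Leonard pair $B,A^*$ and its near-bipartite expansions share $\beta$, and the same $q$ is used for both.) It is known that a parameter array of type I has the form $\theta_i=\delta+\mu q^{2i-d}+hq^{d-2i}$,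 $\theta^*_i=\delta^*+\mu^*q^{2i-d}+h^*q^{d-2i}$ $(0\le i\le d)$, $\varphi_i=(q^i-q^{-i})(q^{d-i+1}-q^{i-d-1})(\tau-\mu\mu^*q^{2i-d-1}-hh^*q^{d-2i+1})$, $\phi_i=(q^i-q^{-i})(q^{d-i+1}-q^{i-d-1})(\tau-h\mu^*q^{2i-d-1}-\mu h^*q^{d-2i+1})$ $(1\le i\le d)$ for a unique sequence $(\delta,\mu,h,\delta^*,\mu^*,h^*,\tau)$ of scalars in $\mathbb{F}$, called the primary $q$-data corresponding to the parameter array. A primary $q$-data of $A,A^*$ is the primary $q$-data corresponding to some parameter array of $A,A^*$. $A,A^*$ has dual $q$-Krawtchouk type if it has type I, $(\theta^*_{i-1}-\theta^*_i)/(\theta^*_i-\theta^*_{i+1})$ is independent of $i$ for $1\le i\le d-1$, and $\varphi_i/\phi_i$ is independent of $i$ for $1\le i\le d$ (then exactly one of $\mu^*,h^*$ is zero); it is reinforced if moreover $q^{2i}\neq-1$ for $1\le i\le d-1$. *)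

theory Defs
  imports
    "Jordan_Normal_Form.Char_Poly"
    "Jordan_Normal_Form.Gauss_Jordan_Elimination"
    "HOL-Computational_Algebra.Computational_Algebra"
begin

text \<open>
  The underlying vector space is $F^{d+1}$, and an endomorphism is the square matrix of size
  $d+1$ by which it acts from the left. A basis is encoded as an invertible matrix \<open>P\<close>
  whose columns are the basis vectors: \<open>A * P = P * M\<close> says that \<open>A\<close> maps the \<open>j\<close>-th basis vector
  to the combination of the basis vectors with coefficients the \<open>j\<close>-th column of \<open>M\<close>.
\<close>

definition basis_mat :: "nat \<Rightarrow> 'a :: field mat \<Rightarrow> bool" where
  "basis_mat n P \<longleftrightarrow> P \<in> carrier_mat n n \<and> invertible_mat P"

definition represents :: "nat \<Rightarrow> 'a :: field mat \<Rightarrow> 'a mat \<Rightarrow> 'a mat \<Rightarrow> bool" where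
  "represents n P A M \<longleftrightarrow> M \<in> carrier_mat n n \<and> A * P = P * M"

definition irred_tridiagonal :: "nat \<Rightarrow> 'a :: field mat \<Rightarrow> bool" where
  "irred_tridiagonal n M \<longleftrightarrow>
     (\<forall>i<n. \<forall>j<n. i + 1 < j \<or> j + 1 < i \<longrightarrow> M $$ (i, j) = 0) \<and>
     (\<forall>i. i + 1 < n \<longrightarrow> M $$ (i, i + 1) \<noteq> 0 \<and> M $$ (i + 1, i) \<noteq> 0)"

definition leonard_pair :: "nat \<Rightarrow> 'a :: field mat \<Rightarrow> 'a mat \<Rightarrow> bool" where
  "leonard_pair d A As \<longleftrightarrow>
     A \<in> carrier_mat (d + 1) (d + 1) \<and> As \<in> carrier_mat (d + 1) (d + 1) \<and>
     (\<exists>P M D. basis_mat (d + 1) P \<and> represents (d + 1) P A M \<and> represents (d + 1) P As D \<and>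
        irred_tridiagonal (d + 1) M \<and> diagonal_mat D) \<and>
     (\<exists>P M D. basis_mat (d + 1) P \<and> represents (d + 1) P As M \<and> represents (d + 1) P A D \<and>
        irred_tridiagonal (d + 1) M \<and> diagonal_mat D)"

text \<open>
  The projection onto the \<open>t\<close>-eigenspace of \<open>S\<close> along the sum of the other eigenspaces. It is
  determined uniquely when \<open>S\<close> is diagonalizable, the only case in which it is used.
\<close>

definition primitive_idempotent :: "'a :: field mat \<Rightarrow> 'a \<Rightarrow> 'a mat" where
  "primitive_idempotent S t =
     (THE E. E \<in> carrier_mat (dim_row S) (dim_row S) \<and>
        (\<forall>v \<in> carrier_vec (dim_row S). S *\<^sub>v v = t \<cdot>\<^sub>v v \<longrightarrow> E *\<^sub>v v = v) \<and>
        (\<forall>s. \<forall>v \<in> carrier_vec (dim_row S).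
           s \<noteq> t \<and> S *\<^sub>v v = s \<cdot>\<^sub>v v \<longrightarrow> E *\<^sub>v v = 0\<^sub>v (dim_row S)))"

text \<open>
  The sum over the primitive idempotents of \<open>As\<close>, taken entrywise because matrices of all sizes
  share one type and so do not form an additive monoid.
\<close>

definition flat_part :: "'a :: field mat \<Rightarrow> 'a mat \<Rightarrow> 'a mat" where
  "flat_part A As = mat (dim_row As) (dim_row As) (\<lambda>(i, j).
     \<Sum>t | eigenvalue As t.
       (primitive_idempotent As t * A * primitive_idempotent As t) $$ (i, j))"

definition bipartite_leonard_pair :: "nat \<Rightarrow> 'a :: field mat \<Rightarrow> 'a mat \<Rightarrow> bool" where
  "bipartite_leonard_pair d A As \<longleftrightarrow>
     leonard_pair d A As \<and> flat_part A As = 0\<^sub>m (d + 1) (d + 1)"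

definition near_bipartite_leonard_pair :: "nat \<Rightarrow> 'a :: field mat \<Rightarrow> 'a mat \<Rightarrow> bool" where
  "near_bipartite_leonard_pair d A As \<longleftrightarrow>
     leonard_pair d A As \<and> leonard_pair d (A - flat_part A As) As"

definition bipartite_contraction :: "'a :: field mat \<Rightarrow> 'a mat \<Rightarrow> 'a mat" where
  "bipartite_contraction A As = A - flat_part A As"

definition near_bipartite_expansion ::
    "nat \<Rightarrow> 'a :: field mat \<Rightarrow> 'a mat \<Rightarrow> 'a mat \<Rightarrow> bool" where
  "near_bipartite_expansion d B As A \<longleftrightarrow>
     bipartite_leonard_pair d B As \<and> near_bipartite_leonard_pair d A As \<and>
     bipartite_contraction A As = B"

definition standard_ordering ::
    "nat \<Rightarrow> 'a :: field mat \<Rightarrow> 'a mat \<Rightarrow> (nat \<Rightarrow> 'a) \<Rightarrow> bool" where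
  "standard_ordering d A As th \<longleftrightarrow>
     bij_betw th {0..d} {t. eigenvalue A t} \<and>
     (\<exists>P M. basis_mat (d + 1) P \<and> represents (d + 1) P A (mat_diag (d + 1) th) \<and>
        represents (d + 1) P As M \<and> irred_tridiagonal (d + 1) M)"

definition lower_bidiagonal :: "nat \<Rightarrow> (nat \<Rightarrow> 'a :: field) \<Rightarrow> 'a mat" where
  "lower_bidiagonal d th = mat (d + 1) (d + 1) (\<lambda>(i, j).
     if i = j then th i else if i = j + 1 then 1 else 0)"

definition upper_bidiagonal :: "nat \<Rightarrow> (nat \<Rightarrow> 'a :: field) \<Rightarrow> (nat \<Rightarrow> 'a) \<Rightarrow> 'a mat" where
  "upper_bidiagonal d ths x = mat (d + 1) (d + 1) (\<lambda>(i, j).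
     if i = j then ths i else if j = i + 1 then x j else 0)"

text \<open>
  Sequences are functions on \<open>nat\<close>; only the values at \<open>0..d\<close> (for eigenvalues) or at \<open>1..d\<close>
  (for the split sequences) matter.
\<close>

definition parameter_array ::
    "nat \<Rightarrow> 'a :: field mat \<Rightarrow> 'a mat \<Rightarrow>
     (nat \<Rightarrow> 'a) \<Rightarrow> (nat \<Rightarrow> 'a) \<Rightarrow> (nat \<Rightarrow> 'a) \<Rightarrow> (nat \<Rightarrow> 'a) \<Rightarrow> bool" where
  "parameter_array d A As th ths vphi phi \<longleftrightarrow>
     leonard_pair d A As \<and> standard_ordering d A As th \<and> standard_ordering d As A ths \<and>
     (\<exists>P. basis_mat (d + 1) P \<and>
        represents (d + 1) P A (lower_bidiagonal d th) \<and>
        represents (d + 1) P As (upper_bidiagonal d ths vphi)) \<and>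
     (\<exists>P. basis_mat (d + 1) P \<and>
        represents (d + 1) P A (lower_bidiagonal d (\<lambda>i. th (d - i))) \<and>
        represents (d + 1) P As (upper_bidiagonal d ths phi))"

text \<open>
  A standard ordering is unique up to reversal, and reversal does not affect the quotients below,
  so the choice of the orderings is immaterial.
\<close>

definition fundamental_constant :: "nat \<Rightarrow> 'a :: field mat \<Rightarrow> 'a mat \<Rightarrow> 'a \<Rightarrow> bool" where
  "fundamental_constant d A As b \<longleftrightarrow>
     3 \<le> d \<and> leonard_pair d A As \<and>
     (\<exists>th ths. standard_ordering d A As th \<and> standard_ordering d As A ths \<and>
        (\<forall>i \<in> {2..d - 1}.
           (th (i - 2) - th (i + 1)) / (th (i - 1) - th i) = b + 1 \<and>
           (ths (i - 2) - ths (i + 1)) / (ths (i - 1) - ths i) = b + 1))"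

text \<open>Type I, with \<open>q\<close> the chosen scalar that parametrizes the fundamental constant.\<close>

definition type_I :: "nat \<Rightarrow> 'a :: field \<Rightarrow> 'a mat \<Rightarrow> 'a mat \<Rightarrow> bool" where
  "type_I d q A As \<longleftrightarrow>
     (\<exists>b. fundamental_constant d A As b \<and> b \<noteq> 2 \<and> b \<noteq> - 2 \<and>
        q \<noteq> 0 \<and> b = q powi 2 + q powi (- 2))"

type_synonym 'a q_data = "'a \<times> 'a \<times> 'a \<times> 'a \<times> 'a \<times> 'a \<times> 'a"

definition primary_q_data_of_array ::
    "nat \<Rightarrow> 'a :: field \<Rightarrow> (nat \<Rightarrow> 'a) \<Rightarrow> (nat \<Rightarrow> 'a) \<Rightarrow> (nat \<Rightarrow> 'a) \<Rightarrow> (nat \<Rightarrow> 'a) \<Rightarrow>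
     'a q_data \<Rightarrow> bool" where
  "primary_q_data_of_array d q th ths vphi phi = (\<lambda>(\<delta>, \<mu>, h, \<delta>s, \<mu>s, hs, \<tau>).
     (\<forall>i \<in> {0..d}.
        th i = \<delta> + \<mu> * q powi (2 * int i - int d) + h * q powi (int d - 2 * int i) \<and>
        ths i = \<delta>s + \<mu>s * q powi (2 * int i - int d) + hs * q powi (int d - 2 * int i)) \<and>
     (\<forall>i \<in> {1..d}.
        vphi i = (q powi int i - q powi (- int i)) *
          (q powi (int d - int i + 1) - q powi (int i - int d - 1)) *
          (\<tau> - \<mu> * \<mu>s * q powi (2 * int i - int d - 1)
             - h * hs * q powi (int d - 2 * int i + 1)) \<and>
        phi i = (q powi int i - q powi (- int i)) *
          (q powi (int d - int i + 1) - q powi (int i - int d - 1)) *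
          (\<tau> - h * \<mu>s * q powi (2 * int i - int d - 1)
             - \<mu> * hs * q powi (int d - 2 * int i + 1))))"

definition primary_q_data ::
    "nat \<Rightarrow> 'a :: field \<Rightarrow> 'a mat \<Rightarrow> 'a mat \<Rightarrow> 'a q_data \<Rightarrow> bool" where
  "primary_q_data d q A As dat \<longleftrightarrow>
     type_I d q A As \<and>
     (\<exists>th ths vphi phi. parameter_array d A As th ths vphi phi \<and>
        primary_q_data_of_array d q th ths vphi phi dat)"

text \<open>
  Passing to another parameter array of the same pair reverses or inverts the quotients below,
  so whether they are constant does not depend on the parameter array.
\<close>

definition dual_q_krawtchouk :: "nat \<Rightarrow> 'a :: field \<Rightarrow> 'a mat \<Rightarrow> 'a mat \<Rightarrow> bool" where
  "dual_q_krawtchouk d q A As \<longleftrightarrow>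
     type_I d q A As \<and>
     (\<exists>th ths vphi phi. parameter_array d A As th ths vphi phi \<and>
        (\<exists>c. \<forall>i \<in> {1..d - 1}. (ths (i - 1) - ths i) / (ths i - ths (i + 1)) = c) \<and>
        (\<exists>c. \<forall>i \<in> {1..d}. vphi i / phi i = c))"

definition reinforced_dual_q_krawtchouk ::
    "nat \<Rightarrow> 'a :: field \<Rightarrow> 'a mat \<Rightarrow> 'a mat \<Rightarrow> bool" where
  "reinforced_dual_q_krawtchouk d q A As \<longleftrightarrow>
     dual_q_krawtchouk d q A As \<and> (\<forall>i \<in> {1..d - 1}. q ^ (2 * i) \<noteq> - 1)"

text \<open>The superdiagonal entry in row \<open>i - 1\<close> and column \<open>i\<close> is \<open>x i\<close>, for \<open>i\<close> in \<open>1..d\<close>.\<close>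

definition normalized_TD_D ::
    "nat \<Rightarrow> 'a :: field mat \<Rightarrow> 'a mat \<Rightarrow> (nat \<Rightarrow> 'a) \<Rightarrow> (nat \<Rightarrow> 'a) \<Rightarrow> bool" where
  "normalized_TD_D d B As x ths \<longleftrightarrow>
     B = mat (d + 1) (d + 1) (\<lambda>(i, j).
       if i = j + 1 then 1 else if j = i + 1 then x j else 0) \<and>
     As = mat_diag (d + 1) ths"

definition K_mat :: "nat \<Rightarrow> 'a :: field \<Rightarrow> 'a mat" where
  "K_mat d q = mat_diag (d + 1) (\<lambda>i. q powi (2 * int i - int d))"

end

theory Submission
  imports Defs
begin

text \<open>
  Since \<open>As\<close> is diagonal with distinct entries, the flat part of \<open>A\<close> is its diagonal, so only the
  diagonal entries \<open>a i\<close> of \<open>A\<close> have to be found. The basis in which \<open>A\<close> is lower and \<open>As\<close> upper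
  bidiagonal forms an upper triangular matrix \<open>P\<close>, and comparing the entries \<open>(i, i - 1)\<close> and
  \<open>(i, i)\<close> of the two sides of \<open>A P = P L\<close> yields
  \<open>a i = th i - vphi i / (ths (i - 1) - ths i) + vphi (i + 1) / (ths i - ths (i + 1))\<close>.
  If \<open>\<mu>s\<close> or \<open>hs\<close> vanishes and \<open>\<tau> = 0\<close>, both quotients are a constant times a product
  of two \<open>q\<close>-integers, whose consecutive differences are \<open>q powi (2 * i - d) - q powi (d - 2 * i)\<close>.
\<close>

section \<open>Bidiagonal products and the diagonal of a split form\<close>

lemma index_mult_mat_sum:
  assumes "A \<in> carrier_mat n n" "B \<in> carrier_mat n n" "i < n" "j < n"
  shows "(A * B) $$ (i, j) = (\<Sum>k<n. A $$ (i, k) * B $$ (k, j))"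
  using assms by (auto simp: scalar_prod_def atLeast0LessThan)

lemma mult_lower_bidiagonal:
  assumes P: "P \<in> carrier_mat (d + 1) (d + 1)" and i: "i \<le> d" and j: "j \<le> d"
  shows "(P * lower_bidiagonal d th) $$ (i, j) =
    P $$ (i, j) * th j + (if j < d then P $$ (i, j + 1) else 0)"
proof -
  have "(P * lower_bidiagonal d th) $$ (i, j) =
      (\<Sum>k<d + 1. P $$ (i, k) * lower_bidiagonal d th $$ (k, j))"
    by (rule index_mult_mat_sum[OF P]) (use i j in \<open>auto simp: lower_bidiagonal_def\<close>)
  also have "\<dots> = (\<Sum>k<d + 1. (if k = j then P $$ (i, j) * th j else 0) +
      (if k = j + 1 then P $$ (i, j + 1) else 0))"
    by (rule sum.cong) (use j in \<open>auto simp: lower_bidiagonal_def\<close>)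
  also have "\<dots> = P $$ (i, j) * th j + (if j < d then P $$ (i, j + 1) else 0)"
    using j by (simp add: sum.distrib del: sum.lessThan_Suc)
  finally show ?thesis .
qed

lemma mult_upper_bidiagonal:
  assumes P: "P \<in> carrier_mat (d + 1) (d + 1)" and i: "i \<le> d" and j: "j \<le> d"
  shows "(P * upper_bidiagonal d ths x) $$ (i, j) =
    P $$ (i, j) * ths j + (if 0 < j then P $$ (i, j - 1) * x j else 0)"
proof -
  have "(P * upper_bidiagonal d ths x) $$ (i, j) =
      (\<Sum>k<d + 1. P $$ (i, k) * upper_bidiagonal d ths x $$ (k, j))"
    by (rule index_mult_mat_sum[OF P]) (use i j in \<open>auto simp: upper_bidiagonal_def\<close>)
  also have "\<dots> = (\<Sum>k<d + 1. (if k = j then P $$ (i, j) * ths j else 0) +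
      (if k = j - 1 then (if 0 < j then P $$ (i, j - 1) * x j else 0) else 0))"
    by (rule sum.cong) (use j in \<open>auto simp: upper_bidiagonal_def\<close>)
  also have "\<dots> = P $$ (i, j) * ths j + (if 0 < j then P $$ (i, j - 1) * x j else 0)"
    using j by (simp add: sum.distrib del: sum.lessThan_Suc)
  finally show ?thesis .
qed

lemma upper_triangular_basis_mat_diag_nonzero:
  assumes P: "basis_mat n P" and tri: "upper_triangular P" and i: "i < n"
  shows "P $$ (i, i) \<noteq> 0"
proof -
  have carr: "P \<in> carrier_mat n n" using P by (simp add: basis_mat_def)
  obtain Q where "P * Q = 1\<^sub>m n" "Q * P = 1\<^sub>m (dim_row Q)"
    using P by (auto simp: basis_mat_def invertible_mat_def inverts_mat_def)
  moreover from this have "dim_col Q = n" "dim_row Q = n"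
    using carr by (metis index_mult_mat(3) index_one_mat(3),
        metis carr carrier_matD(2) index_mult_mat(3) index_one_mat(3))
  then have "Q \<in> carrier_mat n n" by auto
  ultimately have "det P * det Q = 1" using carr by (metis det_mult det_one)
  then have "prod_list (diag_mat P) \<noteq> 0"
    using det_upper_triangular[OF tri carr] by (metis mult_zero_left zero_neq_one)
  then have "0 \<notin> set (diag_mat P)" by (subst (asm) prod_list_zero_iff)
  moreover have "P $$ (i, i) \<in> set (diag_mat P)" using carr i by (auto simp: diag_mat_def)
  ultimately show ?thesis by metis
qed

text \<open>By \<open>hess\<close> and the triangularity of \<open>P\<close>, the term
  \<open>A $$ (i, l) * P $$ (l, j)\<close> survives only for i - 1 \<le> l \<le> j. So the entry (i,
  i - 1) of \<open>A * P\<close> has one term and the entry (i, i) has two, and the first determines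
  the subdiagonal entry of \<open>A\<close> that occurs in the second.\<close>

lemma diagonal_entry_from_split_form:
  fixes A :: "'a :: field mat"
  assumes A: "A \<in> carrier_mat (d + 1) (d + 1)"
    and hess: "\<And>i j. i \<le> d \<Longrightarrow> j + 1 < i \<Longrightarrow> A $$ (i, j) = 0"
    and inj: "inj_on ths {0..d}"
    and P: "basis_mat (d + 1) P"
    and repA: "represents (d + 1) P A (lower_bidiagonal d th)"
    and repAs: "represents (d + 1) P (mat_diag (d + 1) ths) (upper_bidiagonal d ths x)"
    and i: "i \<le> d"
  shows "A $$ (i, i) = th i - (if 0 < i then x i / (ths (i - 1) - ths i) else 0) +
    (if i < d then x (i + 1) / (ths i - ths (i + 1)) else 0)"
proof -
  have carr: "P \<in> carrier_mat (d + 1) (d + 1)" using P by (simp add: basis_mat_def)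
  \<comment> \<open>This is the entry (k, j) of the relation for the diagonal matrix. Off the
    diagonal the factor \<open>ths k - ths j\<close> is nonzero, so column j - 1 of \<open>P\<close>
    determines column j there.\<close>
  have recur: "(ths k - ths j) * P $$ (k, j) = (if 0 < j then P $$ (k, j - 1) * x j else 0)"
    if "k \<le> d" "j \<le> d" for k j
  proof -
    have "ths k * P $$ (k, j) = (P * upper_bidiagonal d ths x) $$ (k, j)"
      using repAs that mat_diag_mult_left[OF carr] unfolding represents_def
      by (metis (no_types, lifting) Suc_eq_plus1 index_mat(1) less_Suc_eq_le prod.case)
    also have "\<dots> = P $$ (k, j) * ths j + (if 0 < j then P $$ (k, j - 1) * x j else 0)"
      by (rule mult_upper_bidiagonal[OF carr that])
    finally show ?thesis by (simp add: algebra_simps)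
  qed
  have ne: "ths k \<noteq> ths j" if "k \<le> d" "j \<le> d" "k \<noteq> j" for k j
    using inj that by (auto dest: inj_onD)
  \<comment> \<open>Induction along row k from column 0, where \<open>recur\<close> has right side
    0; every column before k inherits the zero from its left neighbour.\<close>
  have low: "P $$ (k, j) = 0" if "j < k" "k \<le> d" for j k
    using that
  proof (induction j)
    case 0
    then show ?case using recur[of k 0] ne[of k 0] by simp
  next
    case (Suc j)
    then show ?case using recur[of k "Suc j"] ne[of k "Suc j"] by simp
  qed
  have "upper_triangular P" using carr low by (intro upper_triangularI) auto
  then have nz: "P $$ (k, k) \<noteq> 0" if "k \<le> d" for k
    using upper_triangular_basis_mat_diag_nonzero[OF P] that by simp
  have sup: "P $$ (k, k + 1) = P $$ (k, k) * x (k + 1) / (ths k - ths (k + 1))" if "k < d" for k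
    using recur[of k "k + 1"] ne[of k "k + 1"] that by (simp add: field_simps)
  have AP: "(\<Sum>l<d + 1. A $$ (k, l) * P $$ (l, j)) =
      P $$ (k, j) * th j + (if j < d then P $$ (k, j + 1) else 0)"
    if "k \<le> d" "j \<le> d" for k j
    using repA index_mult_mat_sum[OF A carr] mult_lower_bidiagonal[OF carr that, of th] that
    unfolding represents_def by simp
  have rhs: "th i * P $$ (i, i) + (if i < d then P $$ (i, i + 1) else 0) =
      P $$ (i, i) * (th i + (if i < d then x (i + 1) / (ths i - ths (i + 1)) else 0))"
    using sup[of i] by (simp add: algebra_simps)
  show ?thesis
  proof (cases i)
    case 0
    \<comment> \<open>Row 0 has no subdiagonal entry: column 0 of \<open>P\<close> is a multiple of
      the first unit vector, so a single term remains.\<close>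
    have "(\<Sum>l<d + 1. A $$ (i, l) * P $$ (l, i)) = (\<Sum>l\<in>{i}. A $$ (i, l) * P $$ (l, i))"
      by (rule sum.mono_neutral_right) (use 0 low in auto)
    then show ?thesis using AP[OF i i] rhs nz[OF i] 0
      by (simp add: mult.commute)
  next
    case (Suc m)
    have m: "m \<le> d" "m < d" using i Suc by auto
    have "(\<Sum>l<d + 1. A $$ (i, l) * P $$ (l, m)) = (\<Sum>l\<in>{m}. A $$ (i, l) * P $$ (l, m))"
    proof (rule sum.mono_neutral_right)
      show "\<forall>l\<in>{..<d + 1} - {m}. A $$ (i, l) * P $$ (l, m) = 0"
      proof
        fix l assume "l \<in> {..<d + 1} - {m}"
        then consider "l < m" | "m < l" "l \<le> d" by fastforce
        then show "A $$ (i, l) * P $$ (l, m) = 0"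
          by cases (use Suc i low hess[of i l] in auto)
      qed
    qed (use m in auto)
    \<comment> \<open>The term with \<open>th m\<close> drops out because \<open>P $$ (i, m)\<close>
      lies below the diagonal; the subdiagonal 1 of the bidiagonal matrix leaves
      \<open>P $$ (i, i)\<close>.\<close>
    then have sub: "A $$ (i, m) * P $$ (m, m) = P $$ (i, i)"
      using AP[OF i m(1)] low[of m i] Suc i m by simp
    have "(\<Sum>l<d + 1. A $$ (i, l) * P $$ (l, i)) = (\<Sum>l\<in>{m, i}. A $$ (i, l) * P $$ (l, i))"
    proof (rule sum.mono_neutral_right)
      show "\<forall>l\<in>{..<d + 1} - {m, i}. A $$ (i, l) * P $$ (l, i) = 0"
      proof
        fix l assume "l \<in> {..<d + 1} - {m, i}"
        then consider "l < m" | "i < l" "l \<le> d" using Suc by fastforce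
        then show "A $$ (i, l) * P $$ (l, i) = 0"
          by cases (use Suc i low hess[of i l] in auto)
      qed
    qed (use m i in auto)
    then have "A $$ (i, m) * P $$ (m, i) + A $$ (i, i) * P $$ (i, i) =
        P $$ (i, i) * (th i + (if i < d then x (i + 1) / (ths i - ths (i + 1)) else 0))"
      using AP[OF i i] rhs Suc by (simp add: mult.commute)
    \<comment> \<open>\<open>sup\<close> writes \<open>P $$ (m, i)\<close> as a multiple of
      \<open>P $$ (m, m)\<close>, so \<open>sub\<close> eliminates the unknown
      \<open>A $$ (i, m)\<close>.\<close>
    moreover have "A $$ (i, m) * P $$ (m, i) = P $$ (i, i) * (x i / (ths m - ths i))"
      using sup[OF m(2)] sub Suc by (simp add: mult.assoc[symmetric])
    ultimately have "P $$ (i, i) * A $$ (i, i) = P $$ (i, i) *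
        (th i - x i / (ths m - ths i) + (if i < d then x (i + 1) / (ths i - ths (i + 1)) else 0))"
      by (simp add: algebra_simps)
    then show ?thesis using nz[OF i] Suc by (subst (asm) mult_left_cancel) auto
  qed
qed

section \<open>Idempotents, flat parts and inverses for diagonal matrices\<close>

lemma mult_mat_vec_mat_diag:
  assumes "v \<in> carrier_vec n"
  shows "mat_diag n f *\<^sub>v v = vec n (\<lambda>i. f i * v $ i)"
proof (rule eq_vecI)
  fix i assume "i < dim_vec (vec n (\<lambda>i. f i * v $ i))"
  then have i: "i < n" by simp
  then have "(mat_diag n f *\<^sub>v v) $ i = (\<Sum>k<n. (if i = k then f k else 0) * v $ k)"
    using assms by (simp add: mat_diag_def scalar_prod_def atLeast0LessThan)
  also have "\<dots> = (\<Sum>k<n. if k = i then f i * v $ i else 0)"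
    by (rule sum.cong) auto
  finally have "(mat_diag n f *\<^sub>v v) $ i = (\<Sum>k<n. if k = i then f i * v $ i else 0)" .
  then show "(mat_diag n f *\<^sub>v v) $ i = vec n (\<lambda>i. f i * v $ i) $ i" using i by simp
qed (simp add: mat_diag_def)

text \<open>Injectivity of \<open>f\<close> forces an eigenvector for \<open>f i\<close> to live on
  coordinate i alone, and all other eigenvectors vanish there. Uniqueness follows because the unit
  vectors are eigenvectors, so the two conditions fix every column of the projection.\<close>

lemma primitive_idempotent_mat_diag:
  fixes f :: "nat \<Rightarrow> 'a :: field"
  assumes inj: "inj_on f {..<n}" and i: "i < n"
  shows "primitive_idempotent (mat_diag n f) (f i) = mat_diag n (\<lambda>k. if k = i then 1 else 0)"
proof -
  have dim: "dim_row (mat_diag n f) = n" by (simp add: mat_diag_def)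
  have comp: "f k * v $ k = s * v $ k"
    if "v \<in> carrier_vec n" "mat_diag n f *\<^sub>v v = s \<cdot>\<^sub>v v" "k < n" for s k and v :: "'a vec"
    using arg_cong[OF that(2), of "\<lambda>w. vec_index w k"] that(1,3) by (simp add: mult_mat_vec_mat_diag)
  let ?E = "mat_diag n (\<lambda>k. if k = i then 1 else 0 :: 'a)"
  show ?thesis
    unfolding primitive_idempotent_def dim
  proof (rule the_equality, intro conjI ballI allI impI)
    show "?E \<in> carrier_mat n n" by simp
  next
    fix v assume v: "v \<in> carrier_vec n" "mat_diag n f *\<^sub>v v = f i \<cdot>\<^sub>v v"
    have "v $ k = 0" if "k < n" "k \<noteq> i" for k
      using comp[OF v that(1)] inj that i by (auto dest: inj_onD)
    then show "?E *\<^sub>v v = v" using v by (auto simp: mult_mat_vec_mat_diag)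
  next
    fix s v assume v: "v \<in> carrier_vec n" "s \<noteq> f i \<and> mat_diag n f *\<^sub>v v = s \<cdot>\<^sub>v v"
    have "v $ i = 0" using comp[of v s i] v i by auto
    then show "?E *\<^sub>v v = 0\<^sub>v n" using v by (auto simp: mult_mat_vec_mat_diag)
  next
    fix E assume E: "E \<in> carrier_mat n n \<and>
      (\<forall>v\<in>carrier_vec n. mat_diag n f *\<^sub>v v = f i \<cdot>\<^sub>v v \<longrightarrow> E *\<^sub>v v = v) \<and>
      (\<forall>s. \<forall>v\<in>carrier_vec n. s \<noteq> f i \<and> mat_diag n f *\<^sub>v v = s \<cdot>\<^sub>v v \<longrightarrow> E *\<^sub>v v = 0\<^sub>v n)"
    have eig: "mat_diag n f *\<^sub>v unit_vec n j = f j \<cdot>\<^sub>v unit_vec n j" if "j < n" for j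
      using that by (auto simp: mult_mat_vec_mat_diag unit_vec_def)
    have col: "E *\<^sub>v unit_vec n j = (if j = i then unit_vec n i else 0\<^sub>v n)" if j: "j < n" for j
    proof (cases "j = i")
      case True
      then show ?thesis using E eig[OF i] by simp
    next
      case False
      then have "f j \<noteq> f i" using inj i j by (auto dest: inj_onD)
      then show ?thesis using E eig[OF j] False by simp
    qed
    show "E = ?E"
    proof (rule eq_matI)
      fix k j assume kj: "k < dim_row ?E" "j < dim_col ?E"
      then have "k < n" "j < n" by (auto simp: mat_diag_def)
      moreover have "E $$ (k, j) = (E *\<^sub>v unit_vec n j) $ k"
        using E \<open>k < n\<close> \<open>j < n\<close> by auto
      ultimately show "E $$ (k, j) = ?E $$ (k, j)"
        using col[of j] i by (auto simp: mat_diag_def)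
    qed (use E in \<open>auto simp: mat_diag_def\<close>)
  qed
qed

text \<open>Each idempotent is a diagonal matrix unit by \<open>eig\<close>, so multiplying by it on
  both sides keeps only one diagonal entry of \<open>A\<close>.\<close>

lemma flat_part_mat_diag_off_diagonal:
  assumes A: "A \<in> carrier_mat n n" and inj: "inj_on f {..<n}"
    and eig: "{t. eigenvalue (mat_diag n f) t} \<subseteq> f ` {..<n}"
    and ij: "i < n" "j < n" "i \<noteq> j"
  shows "flat_part A (mat_diag n f) $$ (i, j) = 0"
proof -
  have "(primitive_idempotent (mat_diag n f) t * A * primitive_idempotent (mat_diag n f) t)
      $$ (i, j) = 0" if t: "eigenvalue (mat_diag n f) t" for t
  proof -
    obtain k where k: "k < n" "t = f k" using eig t by blast
    show ?thesis
      unfolding k(2) primitive_idempotent_mat_diag[OF inj k(1)] mat_diag_mult_left[OF A]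
      by (subst mat_diag_mult_right[of _ n n]) (use ij in auto)
  qed
  then show ?thesis using ij by (simp add: flat_part_def mat_diag_def)
qed

text \<open>Membership in the units excludes the result \<open>None\<close>; the matrix returned is
  then the entrywise inverse, since inverses are unique.\<close>

lemma mat_inverse_mat_diag:
  fixes f :: "nat \<Rightarrow> 'a :: field"
  assumes "\<And>i. i < n \<Longrightarrow> f i \<noteq> 0"
  shows "mat_inverse (mat_diag n f) = Some (mat_diag n (\<lambda>i. inverse (f i)))"
proof -
  let ?g = "mat_diag n (\<lambda>i. inverse (f i))"
  have inv: "mat_diag n f * ?g = 1\<^sub>m n" "?g * mat_diag n f = 1\<^sub>m n"
    unfolding mat_diag_diag by (rule eq_matI; simp add: mat_diag_def assms)+
  then have "mat_diag n f \<in> Units (ring_mat TYPE('a) n ())"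
    unfolding Units_def by (auto simp: ring_mat_simps intro!: bexI[of _ ?g])
  then obtain X where X: "mat_inverse (mat_diag n f) = Some X"
    using mat_inverse(1)[of "mat_diag n f" n "()"] by fastforce
  have X': "mat_diag n f * X = 1\<^sub>m n" "X \<in> carrier_mat n n"
    using mat_inverse(2)[OF mat_diag_dim X] by simp_all
  have "X = ?g * mat_diag n f * X" using inv(2) X'(2) by simp
  also have "\<dots> = ?g * (mat_diag n f * X)"
    by (rule assoc_mult_mat[OF mat_diag_dim mat_diag_dim X'(2)])
  also have "\<dots> = ?g" unfolding X'(1) by (rule right_mult_one_mat[OF mat_diag_dim])
  finally have "X = ?g" .
  then show ?thesis using X by simp
qed

section \<open>Products of two q-integers\<close>

definition split_coefficient :: "'a :: field \<Rightarrow> int \<Rightarrow> int \<Rightarrow> 'a" where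
  "split_coefficient q d i =
    (q powi i - q powi (- i)) * (q powi (d - i + 1) - q powi (i - d - 1)) / (q - inverse q)"

text \<open>With [n] = (q^n - q^(-n)) / (q - q^(-1)), \<open>split_coefficient q d i\<close> is (q -
  q^(-1)) [i] [d - i + 1], and the identity behind the difference is [i] [d - i + 1] - [i + 1]
  [d - i] = [2i - d]. Putting a = q^i and b = q^(d - i) makes it a rational identity in a, b and
  q.\<close>

lemma split_coefficient_diff:
  assumes q: "q \<noteq> 0" "q \<noteq> inverse q"
  shows "split_coefficient q d i - split_coefficient q d (i + 1) =
    q powi (2 * i - d) - q powi (d - 2 * i)"
proof -
  define a b where "a = q powi i" and "b = q powi (d - i)"
  have nz: "a \<noteq> 0" "b \<noteq> 0" using q by (auto simp: a_def b_def)
  have pw: "q powi (- i) = inverse a" "q powi (i + 1) = a * q" "q powi (- (i + 1)) = inverse (a * q)"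
    "q powi (d - i + 1) = b * q" "q powi (i - d - 1) = inverse (b * q)"
    "q powi (d - (i + 1) + 1) = b" "q powi ((i + 1) - d - 1) = inverse b"
    "q powi (2 * i - d) = a * inverse b" "q powi (d - 2 * i) = b * inverse a"
    using q(1) unfolding a_def b_def
    by (simp_all flip: power_int_minus power_int_add power_int_add_1)
  have "(a - inverse a) * (b * q - inverse (b * q)) - (a * q - inverse (a * q)) * (b - inverse b) =
      (a * inverse b - b * inverse a) * (q - inverse q)"
    using nz q(1) by (simp add: field_simps)
  then show ?thesis
    using q(2) unfolding split_coefficient_def pw a_def[symmetric] diff_divide_distrib[symmetric]
    by simp
qed

text \<open>
  Thanks to these zeros the entries \<open>i = 0\<close> and \<open>i = d\<close>, where one of the two quotients is absent,
  obey the same formula as the others.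
\<close>

lemma split_coefficient_end [simp]:
  "split_coefficient q d 0 = 0" "split_coefficient q d (d + 1) = 0"
  by (simp_all add: split_coefficient_def)

text \<open>Shared by both cases of the theorem: \<open>y * c\<close> is the last factor of
  \<open>vphi\<close> and \<open>c * (q - inverse q)\<close> the difference of consecutive
  \<open>ths\<close>, so the dependence of \<open>c\<close> on the index cancels.\<close>

lemma split_quotient:
  fixes q c :: "'a :: field"
  assumes "c \<noteq> 0"
  shows "((q powi i - q powi (- i)) * (q powi (d - i + 1) - q powi (i - d - 1)) * (y * c)) /
    (c * (q - inverse q)) = y * split_coefficient q d i"
  using assms by (simp add: split_coefficient_def)

section \<open>The diagonal of the near-bipartite expansion\<close>

theorem theorem26p3:
  fixes d :: nat
    and q :: "'a :: alg_closed_field"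
    and A B As :: "'a mat"
    and th' ths vphi' phi' x' :: "nat \<Rightarrow> 'a"
    and \<delta>' \<mu>' h' \<tau>' \<delta>s \<mu>s hs \<delta> \<mu> h \<tau> :: 'a
  assumes char: "CHAR('a) \<noteq> 2"
    and d: "d \<ge> 3"
    and B_bip: "bipartite_leonard_pair d B As"
    and B_type: "reinforced_dual_q_krawtchouk d q B As"
    and B_array: "parameter_array d B As th' ths vphi' phi'"
    and B_data: "primary_q_data_of_array d q th' ths vphi' phi' (\<delta>', \<mu>', h', \<delta>s, \<mu>s, hs, \<tau>')"
    and B_form: "normalized_TD_D d B As x' ths"
    and \<mu>_nz: "\<mu> \<noteq> 0"
    and \<mu>_cond: "\<forall>s. s ^ 2 = - 1 \<longrightarrow> (\<forall>i \<in> {1 - int d..int d - 1}. \<mu> \<noteq> s * \<mu>' * q powi i)"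
    and \<tau>: "\<tau> = 0"
    and h: "h = \<mu>' * h' / \<mu>"
    and A_exp: "near_bipartite_expansion d B As A"
    and A_data: "primary_q_data d q A As (\<delta>, \<mu>, h, \<delta>s, \<mu>s, hs, \<tau>)"
  shows "(\<mu>s = 0 \<longrightarrow> A = B + (\<mu> + h) \<cdot>\<^sub>m K_mat d q + \<delta> \<cdot>\<^sub>m 1\<^sub>m (d + 1)) \<and>
         (hs = 0 \<longrightarrow> A = B + (\<mu> + h) \<cdot>\<^sub>m the (mat_inverse (K_mat d q)) + \<delta> \<cdot>\<^sub>m 1\<^sub>m (d + 1))"
proof -
  note data = B_data[unfolded primary_q_data_of_array_def prod.case]
  have ths: "ths i = \<delta>s + \<mu>s * q powi (2 * int i - int d) + hs * q powi (int d - 2 * int i)"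
    if "i \<le> d" for i using data that by auto
  have As: "As = mat_diag (d + 1) ths" using B_form by (simp add: normalized_TD_D_def)
  have "bij_betw ths {0..d} {t. eigenvalue As t}"
    using B_array by (simp add: parameter_array_def standard_ordering_def)
  then have inj: "inj_on ths {0..d}" and spec: "{t. eigenvalue As t} = ths ` {0..d}"
    by (auto simp: bij_betw_def)
  have set: "{0..d} = {..<d + 1}" by auto
  have A: "A \<in> carrier_mat (d + 1) (d + 1)" and BA: "A - flat_part A As = B"
    using A_exp by (auto simp: near_bipartite_expansion_def near_bipartite_leonard_pair_def
        leonard_pair_def bipartite_contraction_def)
  have B: "B $$ (i, j) = (if i = j + 1 then 1 else if j = i + 1 then x' j else 0)"
    if "i \<le> d" "j \<le> d" for i j
    using B_form that by (simp add: normalized_TD_D_def)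
  have off: "A $$ (i, j) = B $$ (i, j)" if "i \<le> d" "j \<le> d" "i \<noteq> j" for i j
  proof -
    have "flat_part A As $$ (i, j) = 0"
      unfolding As
      by (rule flat_part_mat_diag_off_diagonal[OF A]) (use inj spec set As that in auto)
    then show ?thesis using A that As by (auto simp flip: BA simp: flat_part_def mat_diag_def)
  qed
  obtain th ths2 vphi phi where arr: "parameter_array d A As th ths2 vphi phi"
    and dat: "primary_q_data_of_array d q th ths2 vphi phi (\<delta>, \<mu>, h, \<delta>s, \<mu>s, hs, \<tau>)"
    and tI: "type_I d q A As"
    using A_data by (auto simp: primary_q_data_def)
  note dat = dat[unfolded primary_q_data_of_array_def prod.case]
  \<comment> \<open>Both parameter arrays share \<delta>s, \<mu>s and hs, so the array of
    \<open>A\<close> lists the eigenvalues of \<open>As\<close> in the order in which they stand on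
    its diagonal.\<close>
  have ths2: "ths2 i = ths i" if "i \<le> d" for i using ths[OF that] dat that by auto
  have th: "th i = \<delta> + \<mu> * q powi (2 * int i - int d) + h * q powi (int d - 2 * int i)"
    if "i \<le> d" for i using dat that by auto
  have vphi: "vphi i = (q powi int i - q powi (- int i)) *
      (q powi (int d - int i + 1) - q powi (int i - int d - 1)) *
      (- \<mu> * \<mu>s * q powi (2 * int i - int d - 1) - h * hs * q powi (int d - 2 * int i + 1))"
    if "1 \<le> i" "i \<le> d" for i using dat that \<tau> by auto
  have q0: "q \<noteq> 0" using tI by (auto simp: type_I_def)
  \<comment> \<open>Otherwise q^2 = 1 and the fundamental constant would be 2, which type I
    excludes.\<close>
  have q1: "q \<noteq> inverse q"
  proof
    assume "q = inverse q"
    then have "q * q = 1" using q0 by (metis right_inverse)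
    then have "q powi 2 + q powi (- 2) = 2" by (simp add: power_int_minus power2_eq_square)
    then show False using tI by (auto simp: type_I_def)
  qed
  have upper_eq: "upper_bidiagonal d ths2 vphi = upper_bidiagonal d ths vphi"
    using ths2 by (auto simp: upper_bidiagonal_def intro!: eq_matI)
  obtain P where P: "basis_mat (d + 1) P" "represents (d + 1) P A (lower_bidiagonal d th)"
    "represents (d + 1) P (mat_diag (d + 1) ths) (upper_bidiagonal d ths vphi)"
    using arr unfolding parameter_array_def upper_eq As by blast
  have hess: "A $$ (i, j) = 0" if "i \<le> d" "j + 1 < i" for i j
    using off[of i j] B[of i j] that by simp
  \<comment> \<open>The two quotients contribute \<open>c\<close> times the difference of the split
    coefficients at i and i + 1, hence the minus sign in the assumption on \<open>c\<close>.\<close>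
  have entry: "A $$ (i, i) = th i + c * (q powi (2 * int i - int d) - q powi (int d - 2 * int i))"
    if i: "i \<le> d" and c: "\<And>j. 1 \<le> j \<Longrightarrow> j \<le> d \<Longrightarrow>
      vphi j / (ths (j - 1) - ths j) = - c * split_coefficient q d j" for i c
  proof -
    have e: "split_coefficient q (int d) (1 + int d) = 0"
      using split_coefficient_end(2)[of q "int d"] by (simp only: add.commute)
    have "(if 0 < i then vphi i / (ths (i - 1) - ths i) else 0) = - c * split_coefficient q d i"
      using c[of i] i by auto
    moreover have "(if i < d then vphi (i + 1) / (ths i - ths (i + 1)) else 0) =
        - c * split_coefficient q d (int i + 1)"
      using c[of "i + 1"] i e by (cases "i = d") (simp_all add: add.commute)
    ultimately show ?thesis
      using diagonal_entry_from_split_form[OF A hess inj P i]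
      unfolding split_coefficient_diff[OF q0 q1, symmetric] by (simp add: algebra_simps)
  qed
  have ne: "ths 0 \<noteq> ths 1" using inj d by (auto dest: inj_onD)
  \<comment> \<open>Off the diagonal \<open>A\<close> agrees with \<open>B\<close>, and
    \<open>B\<close> has zero diagonal, so both cases reduce to the diagonal entries of
    \<open>A\<close>.\<close>
  have eqI: "A = B + X + \<delta> \<cdot>\<^sub>m 1\<^sub>m (d + 1)"
    if X: "X = s \<cdot>\<^sub>m mat_diag (d + 1) f" and
      diag: "\<And>i. i \<le> d \<Longrightarrow> A $$ (i, i) = s * f i + \<delta>" for X s f
  proof (rule eq_matI)
    fix i j assume "i < dim_row (B + X + \<delta> \<cdot>\<^sub>m 1\<^sub>m (d + 1))"
      "j < dim_col (B + X + \<delta> \<cdot>\<^sub>m 1\<^sub>m (d + 1))"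
    then have ij: "i \<le> d" "j \<le> d" by auto
    then show "A $$ (i, j) = (B + X + \<delta> \<cdot>\<^sub>m 1\<^sub>m (d + 1)) $$ (i, j)"
      using off[OF ij] B[OF ij] diag[of i] by (cases "i = j") (auto simp: X mat_diag_def)
  qed (use A in auto)
  show ?thesis
  proof (intro conjI impI)
    assume \<mu>s: "\<mu>s = 0"
    \<comment> \<open>If \<mu>s and hs both vanished, \<open>ths\<close> would be constant.\<close>
    have hs: "hs \<noteq> 0" using ne ths[of 0] ths[of 1] d \<mu>s by auto
    have quot: "vphi j / (ths (j - 1) - ths j) = - h * split_coefficient q d j"
      if j: "1 \<le> j" "j \<le> d" for j
    proof -
      \<comment> \<open>The exponent d - 2j + 1 lies midway between those of
        \<open>ths (j - 1)\<close> and \<open>ths j\<close>, so factoring out this power leaves q -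
        q^(-1). The same power occurs in \<open>vphi j\<close>.\<close>
      define c where "c = hs * q powi (int d - 2 * int j + 1)"
      have "ths (j - 1) - ths j =
          hs * (q powi (int d - 2 * int j + 1 + 1) - q powi (int d - 2 * int j + 1 - 1))"
        using ths[of "j - 1"] ths[of j] j \<mu>s by (simp add: of_nat_diff algebra_simps)
      also have "\<dots> = c * (q - inverse q)"
        using q0 by (simp add: c_def power_int_add power_int_diff power2_eq_square field_simps)
      finally have "ths (j - 1) - ths j = c * (q - inverse q)" .
      moreover have "c \<noteq> 0" using hs q0 by (simp add: c_def)
      ultimately show ?thesis
        using vphi[OF j] split_quotient[of c q "int j" "int d" "- h"] \<mu>s
        by (simp add: c_def mult.assoc)
    qed
    \<comment> \<open>Here \<open>entry\<close> is used with \<open>c\<close> equal to h, which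
      cancels the term of \<open>th i\<close> in q^(d - 2i) and moves its coefficient to q^(2i -
      d).\<close>
    have "A $$ (i, i) = (\<mu> + h) * q powi (2 * int i - int d) + \<delta>" if "i \<le> d" for i
      using entry[OF that quot] th[OF that] by (simp add: algebra_simps)
    then show "A = B + (\<mu> + h) \<cdot>\<^sub>m K_mat d q + \<delta> \<cdot>\<^sub>m 1\<^sub>m (d + 1)"
      by (intro eqI) (auto simp: K_mat_def)
  next
    assume hs: "hs = 0"
    have \<mu>s: "\<mu>s \<noteq> 0" using ne ths[of 0] ths[of 1] d hs by auto
    \<comment> \<open>The double negation matches the form required by \<open>entry\<close>, now
      with \<open>c\<close> equal to -\<mu>.\<close>
    have quot: "vphi j / (ths (j - 1) - ths j) = - (- \<mu>) * split_coefficient q d j"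
      if j: "1 \<le> j" "j \<le> d" for j
    proof -
      \<comment> \<open>Again the middle power; the exponents in \<open>ths\<close> now increase
        with the index, whence the minus sign.\<close>
      define c where "c = - \<mu>s * q powi (2 * int j - int d - 1)"
      have "ths (j - 1) - ths j =
          \<mu>s * (q powi (2 * int j - int d - 1 - 1) - q powi (2 * int j - int d - 1 + 1))"
        using ths[of "j - 1"] ths[of j] j hs by (simp add: of_nat_diff algebra_simps)
      also have "\<dots> = c * (q - inverse q)"
        using q0 by (simp add: c_def power_int_add power_int_diff power2_eq_square field_simps)
      finally have "ths (j - 1) - ths j = c * (q - inverse q)" .
      moreover have "c \<noteq> 0" using \<mu>s q0 by (simp add: c_def)
      ultimately show ?thesis
        using vphi[OF j] split_quotient[of c q "int j" "int d" \<mu>] hs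
        by (simp add: c_def mult.assoc)
    qed
    have "A $$ (i, i) = (\<mu> + h) * inverse (q powi (2 * int i - int d)) + \<delta>" if "i \<le> d" for i
      using entry[OF that quot] th[OF that] by (simp add: algebra_simps flip: power_int_minus)
    moreover have "the (mat_inverse (K_mat d q)) =
        mat_diag (d + 1) (\<lambda>i. inverse (q powi (2 * int i - int d)))"
      unfolding K_mat_def using q0 by (subst mat_inverse_mat_diag) auto
    ultimately show "A = B + (\<mu> + h) \<cdot>\<^sub>m the (mat_inverse (K_mat d q)) + \<delta> \<cdot>\<^sub>m 1\<^sub>m (d + 1)"
      by (intro eqI) auto
  qed
qed

end
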